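(* (a) If $A$ is a Cayley-Dickson doubling of $B$ and $A$ is simple, then $B$ is $\sigma$-simple; and if $A$ is a classical Cayley-Dickson doubling of $B$ and $A$ is $\sigma$-simple, then $B$ is $\sigma$-simple. (b) If $A$ is a (classical or not) Cayley-Dickson doubling of $B$, $B$ is $\sigma$-simple and $Z(A)$ is simple, then $A$ is simple.
   Context: Rings are not necessarily associative. Ideals are two-sided. A ring is simple if it has no ideals other than $\{0\}$ and itself. The center $Z(A)$ is the set of elements of $A$ commuting with every element of $A$. Cayley-Dickson doubling: Let $B$ be a unital ring, let $\sigma:B\to B$ be either a ring automorphism or a ring anti-automorphism with $\sigma^2=\mathrm{id}_B$, and let $\alpha$ be a unit of $B$ which associates and commutes with elements of $B$, i.e. $\alpha(bc)=(b\alpha)c=b(\alpha c)=(bc)\alpha$ for all $b,c\in B$. Let $G=\{e,g\}$ be the group of order two with identity $e$ and, for each $(p,q)\in G\times G$, let $*_{p,q}$ be either the ordinary multiplication of $B$ or its opposite multiplication. The Cayley-Dickson doubling $A$ of $B$ is the set of formal sums $a+bu_g$ with $a,b\in B$, with componentwise addition and product $$(a+bu_g)(c+du_g)=a*_{e,e}c+(b*_{g,g}\sigma(d))\alpha+(a*_{e,g}d+b*_{g,e}\sigma(c))u_g .$$ It is called classical if $\sigma$ is a ring anti-automorphism and $a*_{e,e}b=ab$, $a*_{e,g}b=ba$, $a*_{g,e}b=ab$, $a*_{g,g}b=ba$ for all $a,b\in B$. In the classical case $\sigma$ is extended to $A$ by $\sigma(a+bu_g)=\sigma(a)-bu_g$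 for $a,b\in B$. For $R=B$ (or $R=A$ in the classical case), an ideal $I$ of $R$ is $\sigma$-invariant if $\sigma(I)\subseteq I$, and $R$ is $\sigma$-simple if there is no non-trivial $\sigma$-invariant ideal of $R$ (i.e. none other than $\{0\}$ and $R$). *)

theory Defs
  imports "HOL-Algebra.QuotRing"
begin

text \<open>
  Rings here need be neither associative nor unital, so the HOL-Algebra locale \<open>ring\<close>
  does not apply; its records and additive theory are reused. The \<open>\<one>\<close> field carries
  meaning only in the unital case.
\<close>

locale nonassoc_ring = abelian_group R for R (structure) +
  assumes mult_closed: "\<lbrakk> x \<in> carrier R; y \<in> carrier R \<rbrakk> \<Longrightarrow> x \<otimes> y \<in> carrier R"
    and distrib_right: "\<lbrakk> x \<in> carrier R; y \<in> carrier R; z \<in> carrier R \<rbrakk>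
      \<Longrightarrow> (x \<oplus> y) \<otimes> z = x \<otimes> z \<oplus> y \<otimes> z"
    and distrib_left: "\<lbrakk> x \<in> carrier R; y \<in> carrier R; z \<in> carrier R \<rbrakk>
      \<Longrightarrow> z \<otimes> (x \<oplus> y) = z \<otimes> x \<oplus> z \<otimes> y"

locale unital_nonassoc_ring = nonassoc_ring +
  assumes unit_closed: "\<one> \<in> carrier R"
    and unit_left: "x \<in> carrier R \<Longrightarrow> \<one> \<otimes> x = x"
    and unit_right: "x \<in> carrier R \<Longrightarrow> x \<otimes> \<one> = x"

locale nonassoc_ideal = additive_subgroup I R + nonassoc_ring R for I and R (structure) +
  assumes ideal_left: "\<lbrakk> a \<in> I; x \<in> carrier R \<rbrakk> \<Longrightarrow> x \<otimes> a \<in> I"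
    and ideal_right: "\<lbrakk> a \<in> I; x \<in> carrier R \<rbrakk> \<Longrightarrow> a \<otimes> x \<in> I"

text \<open>No non-degeneracy is imposed: the zero ring counts as simple.\<close>

locale simple_nonassoc_ring = nonassoc_ring +
  assumes trivial_ideals: "nonassoc_ideal I R \<Longrightarrow> I = {\<zero>} \<or> I = carrier R"

locale sigma_simple_ring = nonassoc_ring R for R (structure) and \<sigma> +
  assumes trivial_invariant_ideals:
    "\<lbrakk> nonassoc_ideal I R; \<sigma> ` I \<subseteq> I \<rbrakk> \<Longrightarrow> I = {\<zero>} \<or> I = carrier R"

text \<open>
  The center only asks for commutation, not association, so in general it is merely an
  additive subgroup. Applying \<open>simple_nonassoc_ring\<close> to \<open>center_ring R\<close> therefore
  includes that the center is closed under multiplication.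
\<close>

definition center :: "('a, 'm) ring_scheme \<Rightarrow> 'a set" where
  "center R = {z \<in> carrier R. \<forall>x \<in> carrier R. z \<otimes>\<^bsub>R\<^esub> x = x \<otimes>\<^bsub>R\<^esub> z}"

definition center_ring :: "('a, 'm) ring_scheme \<Rightarrow> ('a, 'm) ring_scheme" where
  "center_ring R = R\<lparr>carrier := center R\<rparr>"

definition opposite_ring :: "('a, 'm) ring_scheme \<Rightarrow> ('a, 'm) ring_scheme" where
  "opposite_ring R = R\<lparr>mult := (\<lambda>x y. y \<otimes>\<^bsub>R\<^esub> x)\<rparr>"

text \<open>The group of order two only serves to index the four multiplications.\<close>

datatype order_two = Grp_e | Grp_g

text \<open>
  \<open>st p q\<close> is the multiplication \<open>*\<^sub>p\<^sub>,\<^sub>q\<close>. Since \<open>\<sigma>\<close> is an involution of a unital ring,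
  \<open>ring_iso\<close> preserving \<open>\<one>\<close> is no extra condition.
\<close>

locale cayley_dickson = unital_nonassoc_ring B for B (structure) +
  fixes \<sigma> :: "'a \<Rightarrow> 'a" and \<alpha> :: 'a
    and st :: "order_two \<Rightarrow> order_two \<Rightarrow> 'a \<Rightarrow> 'a \<Rightarrow> 'a"
  assumes sigma_auto_or_anti: "\<sigma> \<in> ring_iso B B \<or> \<sigma> \<in> ring_iso B (opposite_ring B)"
    and sigma_involution: "b \<in> carrier B \<Longrightarrow> \<sigma> (\<sigma> b) = b"
    and alpha_unit: "\<alpha> \<in> Units B"
    and alpha_assoc_comm: "\<lbrakk> b \<in> carrier B; c \<in> carrier B \<rbrakk> \<Longrightarrow>
      \<alpha> \<otimes> (b \<otimes> c) = (b \<otimes> \<alpha>) \<otimes> c \<and> (b \<otimes> \<alpha>) \<otimes> c = b \<otimes> (\<alpha> \<otimes> c) \<and>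
      b \<otimes> (\<alpha> \<otimes> c) = (b \<otimes> c) \<otimes> \<alpha>"
    and star_mult_or_opposite:
      "(\<forall>a \<in> carrier B. \<forall>b \<in> carrier B. st p q a b = a \<otimes> b) \<or>
       (\<forall>a \<in> carrier B. \<forall>b \<in> carrier B. st p q a b = b \<otimes> a)"

locale classical_cayley_dickson = cayley_dickson +
  assumes sigma_anti: "\<sigma> \<in> ring_iso B (opposite_ring B)"
    and star_ee: "\<lbrakk> a \<in> carrier B; b \<in> carrier B \<rbrakk> \<Longrightarrow> st Grp_e Grp_e a b = a \<otimes> b"
    and star_eg: "\<lbrakk> a \<in> carrier B; b \<in> carrier B \<rbrakk> \<Longrightarrow> st Grp_e Grp_g a b = b \<otimes> a"
    and star_ge: "\<lbrakk> a \<in> carrier B; b \<in> carrier B \<rbrakk> \<Longrightarrow> st Grp_g Grp_e a b = a \<otimes> b"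
    and star_gg: "\<lbrakk> a \<in> carrier B; b \<in> carrier B \<rbrakk> \<Longrightarrow> st Grp_g Grp_g a b = b \<otimes> a"

text \<open>The formal sum \<open>a + b u\<^sub>g\<close> is the pair \<open>(a, b)\<close>.\<close>

definition doubling :: "('a, 'm) ring_scheme \<Rightarrow> ('a \<Rightarrow> 'a) \<Rightarrow> 'a \<Rightarrow>
    (order_two \<Rightarrow> order_two \<Rightarrow> 'a \<Rightarrow> 'a \<Rightarrow> 'a) \<Rightarrow> ('a \<times> 'a) ring" where
  "doubling B \<sigma> \<alpha> st =
    \<lparr>carrier = carrier B \<times> carrier B,
     mult = (\<lambda>(a, b) (c, d).
       (st Grp_e Grp_e a c \<oplus>\<^bsub>B\<^esub> st Grp_g Grp_g b (\<sigma> d) \<otimes>\<^bsub>B\<^esub> \<alpha>,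
        st Grp_e Grp_g a d \<oplus>\<^bsub>B\<^esub> st Grp_g Grp_e b (\<sigma> c))),
     one = (\<one>\<^bsub>B\<^esub>, \<zero>\<^bsub>B\<^esub>),
     zero = (\<zero>\<^bsub>B\<^esub>, \<zero>\<^bsub>B\<^esub>),
     add = (\<lambda>(a, b) (c, d). (a \<oplus>\<^bsub>B\<^esub> c, b \<oplus>\<^bsub>B\<^esub> d))\<rparr>"

definition extended_sigma :: "('a, 'm) ring_scheme \<Rightarrow> ('a \<Rightarrow> 'a) \<Rightarrow> 'a \<times> 'a \<Rightarrow> 'a \<times> 'a" where
  "extended_sigma B \<sigma> = (\<lambda>(a, b). (\<sigma> a, \<ominus>\<^bsub>B\<^esub> b))"

end

(*
  If I is a sigma-invariant ideal of B, then I + I u is an ideal of A, which gives (a).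

  For (b) let I be a nonzero ideal of A. Multiplying by u swaps the two coordinates up to sigma
  and the unit alpha, so the projection of I to the first coordinate is a nonzero sigma-invariant
  ideal of B and hence all of B; so is {a. (a, 0) : I}, unless it is zero. If it is B, then I
  contains 1. If it is zero, then an element of I with one vanishing coordinate is zero. Pick
  (1, b) in I. All its commutators with (c, 0) and (0, d) lie in I and have a vanishing
  coordinate, so (1, b) is central, and simplicity of the center puts 1 into I.
*)
theory Submission
  imports Defs
begin

section \<open>Nonassociative rings and their two-sided ideals\<close>

context nonassoc_ring
begin

lemma r_null: "x \<in> carrier R \<Longrightarrow> x \<otimes> \<zero> = \<zero>"
  by (metis add.l_cancel_one distrib_left l_zero mult_closed zero_closed)

lemma l_null: "x \<in> carrier R \<Longrightarrow> \<zero> \<otimes> x = \<zero>"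
  by (metis add.l_cancel_one distrib_right l_zero mult_closed zero_closed)

lemma diff_eq_zeroD:
  assumes "x \<in> carrier R" "y \<in> carrier R" "x \<ominus> y = \<zero>"
  shows "x = y"
  using assms minus_equality[of x "\<ominus> y"] by (simp add: a_minus_def)

lemma nonassoc_idealI:
  assumes "I \<subseteq> carrier R" "\<zero> \<in> I"
    and "\<And>a b. \<lbrakk> a \<in> I; b \<in> I \<rbrakk> \<Longrightarrow> a \<oplus> b \<in> I"
    and "\<And>a. a \<in> I \<Longrightarrow> \<ominus> a \<in> I"
    and "\<And>a x. \<lbrakk> a \<in> I; x \<in> carrier R \<rbrakk> \<Longrightarrow> x \<otimes> a \<in> I"
    and "\<And>a x. \<lbrakk> a \<in> I; x \<in> carrier R \<rbrakk> \<Longrightarrow> a \<otimes> x \<in> I"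
  shows "nonassoc_ideal I R"
proof -
  have "additive_subgroup I R"
    using assms(1-4) by (unfold_locales) (auto simp: a_inv_def)
  then show ?thesis
    using assms(5,6) nonassoc_ring_axioms
    by (auto simp: nonassoc_ideal_def nonassoc_ideal_axioms_def)
qed

end

context nonassoc_ideal
begin

lemma minus_mem: "a \<in> I \<Longrightarrow> \<ominus> a \<in> I"
  using add.subgroupE(3)[OF a_subgroup] by (simp add: a_inv_def)

lemma diff_mem: "\<lbrakk> a \<in> I; b \<in> I \<rbrakk> \<Longrightarrow> a \<ominus> b \<in> I"
  by (simp add: a_closed minus_mem minus_eq)

end

lemma (in unital_nonassoc_ring) ideal_eq_carrier:
  assumes "nonassoc_ideal I R" "\<one> \<in> I"
  shows "I = carrier R"
proof -
  interpret nonassoc_ideal I R by fact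
  show ?thesis
    using assms(2) ideal_left unit_right a_subset by (metis subsetI subset_antisym)
qed

section \<open>The doubling as a unital ring\<close>

context cayley_dickson
begin

abbreviation A where "A \<equiv> doubling B \<sigma> \<alpha> st"

lemma sigma_closed [simp]: "x \<in> carrier B \<Longrightarrow> \<sigma> x \<in> carrier B"
  using sigma_auto_or_anti by (auto simp: ring_iso_def ring_hom_def opposite_ring_def)

lemma sigma_add:
  "\<lbrakk> x \<in> carrier B; y \<in> carrier B \<rbrakk> \<Longrightarrow> \<sigma> (x \<oplus> y) = \<sigma> x \<oplus> \<sigma> y"
  using sigma_auto_or_anti by (auto simp: ring_iso_def ring_hom_def opposite_ring_def)

lemma sigma_one [simp]: "\<sigma> \<one> = \<one>"
  using sigma_auto_or_anti by (auto simp: ring_iso_def ring_hom_def opposite_ring_def)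

lemma sigma_zero [simp]: "\<sigma> \<zero> = \<zero>"
  by (metis add.l_cancel_one l_zero sigma_add sigma_closed zero_closed)

lemma alpha_closed [simp]: "\<alpha> \<in> carrier B"
  using alpha_unit by (simp add: Units_def)

lemma st_closed [simp]: "\<lbrakk> a \<in> carrier B; b \<in> carrier B \<rbrakk> \<Longrightarrow> st p q a b \<in> carrier B"
  using star_mult_or_opposite[of p q] mult_closed by auto

lemma st_add_left:
  "\<lbrakk> a \<in> carrier B; b \<in> carrier B; c \<in> carrier B \<rbrakk>
    \<Longrightarrow> st p q (a \<oplus> b) c = st p q a c \<oplus> st p q b c"
  using star_mult_or_opposite[of p q] distrib_left distrib_right by auto

lemma st_add_right:
  "\<lbrakk> a \<in> carrier B; b \<in> carrier B; c \<in> carrier B \<rbrakk>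
    \<Longrightarrow> st p q c (a \<oplus> b) = st p q c a \<oplus> st p q c b"
  using star_mult_or_opposite[of p q] distrib_left distrib_right by auto

lemma st_zero [simp]:
  assumes "a \<in> carrier B"
  shows "st p q a \<zero> = \<zero>" "st p q \<zero> a = \<zero>"
  using star_mult_or_opposite[of p q] assms l_null r_null by auto

lemma st_one [simp]:
  assumes "a \<in> carrier B"
  shows "st p q a \<one> = a" "st p q \<one> a = a"
  using star_mult_or_opposite[of p q] assms unit_left unit_right unit_closed by auto

lemma st_mem_ideal:
  assumes "nonassoc_ideal I B" "x \<in> carrier B" "a \<in> I"
  shows "st p q a x \<in> I" "st p q x a \<in> I"
proof -
  interpret nonassoc_ideal I B by fact
  show "st p q a x \<in> I" "st p q x a \<in> I"
    using star_mult_or_opposite[of p q] assms ideal_left ideal_right a_Hcarr by metis+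
qed

text \<open>It is unknown whether \<open>st p q\<close> is the multiplication or its opposite, but
  in either case the two values are the two products of \<open>a\<close> and \<open>x\<close>,
  possibly in swapped order. So ideal closure transfers from \<open>st\<close> back to
  \<open>B\<close>.\<close>

lemma mult_mem_if_st_mem:
  assumes "I \<subseteq> carrier B" "x \<in> carrier B" "a \<in> I" "st p q a x \<in> I" "st p q x a \<in> I"
  shows "a \<otimes> x \<in> I" "x \<otimes> a \<in> I"
  using star_mult_or_opposite[of p q] assms by (metis subsetD)+

text \<open>Cancels \<alpha>: for a right inverse \<beta> of \<alpha>, the law
  \<open>alpha_assoc_comm\<close> gives (x \<alpha>) \<beta> = x (\<alpha> \<beta>) = x although
  \<open>B\<close> need not be associative.\<close>

lemma mem_ideal_if_mult_alpha:
  assumes "nonassoc_ideal I B" "x \<in> carrier B" "x \<otimes> \<alpha> \<in> I"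
  shows "x \<in> I"
proof -
  interpret nonassoc_ideal I B by fact
  obtain \<beta> where \<beta>: "\<beta> \<in> carrier B" "\<alpha> \<otimes> \<beta> = \<one>"
    using alpha_unit by (auto simp: Units_def)
  then show ?thesis
    using alpha_assoc_comm assms unit_right ideal_right by metis
qed

lemma doubling_simps [simp]:
  "carrier A = carrier B \<times> carrier B"
  "\<zero>\<^bsub>A\<^esub> = (\<zero>, \<zero>)"
  "\<one>\<^bsub>A\<^esub> = (\<one>, \<zero>)"
  "(a, b) \<oplus>\<^bsub>A\<^esub> (c, d) = (a \<oplus> c, b \<oplus> d)"
  by (simp_all add: doubling_def)

lemma doubling_mult:
  "(a, b) \<otimes>\<^bsub>A\<^esub> (c, d) =
    (st Grp_e Grp_e a c \<oplus> st Grp_g Grp_g b (\<sigma> d) \<otimes> \<alpha>,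
     st Grp_e Grp_g a d \<oplus> st Grp_g Grp_e b (\<sigma> c))"
  by (simp add: doubling_def)

lemma doubling_abelian_group: "abelian_group A"
proof (rule abelian_groupI)
  fix x assume "x \<in> carrier A"
  then obtain a b where "x = (a, b)" "a \<in> carrier B" "b \<in> carrier B" by auto
  then show "\<exists>y\<in>carrier A. y \<oplus>\<^bsub>A\<^esub> x = \<zero>\<^bsub>A\<^esub>"
    by (intro bexI[of _ "(\<ominus> a, \<ominus> b)"]) (auto simp: l_neg)
qed (auto simp: a_ac)

sublocale A: unital_nonassoc_ring A
proof -
  interpret A: abelian_group A by (rule doubling_abelian_group)
  show "unital_nonassoc_ring A"
    by unfold_locales
      (auto simp: doubling_mult mult_closed sigma_add st_add_left st_add_right distrib_right
        l_null unit_closed a_ac)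
qed

lemma doubling_minus [simp]:
  "\<lbrakk> a \<in> carrier B; b \<in> carrier B \<rbrakk> \<Longrightarrow> \<ominus>\<^bsub>A\<^esub> (a, b) = (\<ominus> a, \<ominus> b)"
  by (rule A.minus_equality) (auto simp: l_neg)

lemma doubling_diff:
  "\<lbrakk> a \<in> carrier B; b \<in> carrier B; c \<in> carrier B; d \<in> carrier B \<rbrakk>
    \<Longrightarrow> (a, b) \<ominus>\<^bsub>A\<^esub> (c, d) = (a \<ominus> c, b \<ominus> d)"
  by (simp add: a_minus_def)

section \<open>From invariant ideals of \<open>B\<close> to ideals of \<open>A\<close>: part
  (a)\<close>

lemma invariant_ideal_Times:
  assumes "nonassoc_ideal I B" "\<sigma> ` I \<subseteq> I"
  shows "nonassoc_ideal (I \<times> I) A"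
proof -
  interpret I: nonassoc_ideal I B by fact
  \<comment> \<open>An element of \<open>I\<close> in the right-hand factor of a product may enter
    through \<sigma>, so absorption from both sides needs invariance.\<close>
  have \<sigma>: "\<sigma> a \<in> I" if "a \<in> I" for a using that assms(2) by auto
  show ?thesis
  proof (rule A.nonassoc_idealI)
    fix x y assume "x \<in> I \<times> I" "y \<in> carrier A"
    then obtain a b c d where "x = (a, b)" "y = (c, d)" "a \<in> I" "b \<in> I"
      "c \<in> carrier B" "d \<in> carrier B"
      by auto
    then show "x \<otimes>\<^bsub>A\<^esub> y \<in> I \<times> I" "y \<otimes>\<^bsub>A\<^esub> x \<in> I \<times> I"
      by (simp_all add: doubling_mult I.ideal_right \<sigma> st_mem_ideal[OF assms(1)])
  qed (auto simp: I.minus_mem I.a_Hcarr)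
qed

text \<open>The common core of both claims of (a), which differ only in the notion of simplicity of
  \<open>A\<close> that makes \<open>I \<times> I\<close> trivial.\<close>

lemma sigma_simple_if_Times_trivial:
  assumes "\<And>I. \<lbrakk> nonassoc_ideal I B; \<sigma> ` I \<subseteq> I; nonassoc_ideal (I \<times> I) A \<rbrakk>
    \<Longrightarrow> I \<times> I = {\<zero>\<^bsub>A\<^esub>} \<or> I \<times> I = carrier A"
  shows "sigma_simple_ring B \<sigma>"
proof unfold_locales
  fix I assume I: "nonassoc_ideal I B" "\<sigma> ` I \<subseteq> I"
  then have "I \<times> I = {\<zero>\<^bsub>A\<^esub>} \<or> I \<times> I = carrier A"
    using assms invariant_ideal_Times by blast
  \<comment> \<open>Writing the zero ideal as a product of singletons lets
    \<open>times_eq_iff\<close> compare the factors.\<close>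
  then have "I \<times> I = {\<zero>} \<times> {\<zero>} \<or> I \<times> I = carrier B \<times> carrier B" by simp
  then show "I = {\<zero>} \<or> I = carrier B"
    unfolding times_eq_iff by blast
qed

lemma sigma_simple_if_doubling_simple:
  assumes "simple_nonassoc_ring A"
  shows "sigma_simple_ring B \<sigma>"
  using simple_nonassoc_ring.trivial_ideals[OF assms] by (rule sigma_simple_if_Times_trivial)

lemma sigma_simple_if_doubling_sigma_simple:
  assumes "sigma_simple_ring A (extended_sigma B \<sigma>)"
  shows "sigma_simple_ring B \<sigma>"
proof (rule sigma_simple_if_Times_trivial)
  fix I assume I: "nonassoc_ideal I B" "\<sigma> ` I \<subseteq> I" "nonassoc_ideal (I \<times> I) A"
  \<comment> \<open>The extension is \<sigma> on the first coordinate and negation on the second,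
    and \<open>I\<close> is stable under both.\<close>
  have "extended_sigma B \<sigma> ` (I \<times> I) \<subseteq> I \<times> I"
    using I(2) nonassoc_ideal.minus_mem[OF I(1)] by (auto simp: extended_sigma_def)
  then show "I \<times> I = {\<zero>\<^bsub>A\<^esub>} \<or> I \<times> I = carrier A"
    using sigma_simple_ring.trivial_invariant_ideals[OF assms I(3)] by blast
qed

section \<open>Two ideals of \<open>B\<close> attached to an ideal of \<open>A\<close>: its
  projection and its base part \<open>{a. (a, \<zero>) \<in> I}\<close>\<close>

lemma ideal_mult_u:
  assumes "nonassoc_ideal I A" "(a, b) \<in> I"
  shows "(b \<otimes> \<alpha>, a) \<in> I" "(\<sigma> b \<otimes> \<alpha>, \<sigma> a) \<in> I"
proof -
  interpret I: nonassoc_ideal I A by fact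
  have ab: "a \<in> carrier B" "b \<in> carrier B" using I.a_Hcarr[OF assms(2)] by auto
  \<comment> \<open>This is u. Since one factor in every \<open>st\<close> is then \<zero> or
    \<one>, the products do not depend on the choice of the four multiplications.\<close>
  have u: "(\<zero>, \<one>) \<in> carrier A" using unit_closed by simp
  show "(b \<otimes> \<alpha>, a) \<in> I" "(\<sigma> b \<otimes> \<alpha>, \<sigma> a) \<in> I"
    using I.ideal_right[OF assms(2) u] I.ideal_left[OF assms(2) u] ab
    by (simp_all add: doubling_mult unit_closed mult_closed)
qed

lemma ideal_mult_base:
  assumes "nonassoc_ideal I A" "(a, b) \<in> I" "c \<in> carrier B"
  shows "(st Grp_e Grp_e a c, st Grp_g Grp_e b (\<sigma> c)) \<in> I"
    and "(st Grp_e Grp_e c a, st Grp_e Grp_g c b) \<in> I"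
proof -
  interpret I: nonassoc_ideal I A by fact
  have ab: "a \<in> carrier B" "b \<in> carrier B" using I.a_Hcarr[OF assms(2)] by auto
  have c: "(c, \<zero>) \<in> carrier A" using assms(3) by simp
  show "(st Grp_e Grp_e a c, st Grp_g Grp_e b (\<sigma> c)) \<in> I"
      "(st Grp_e Grp_e c a, st Grp_e Grp_g c b) \<in> I"
    using I.ideal_right[OF assms(2) c] I.ideal_left[OF assms(2) c] ab assms(3)
    by (simp_all add: doubling_mult l_null)
qed

lemma projection_ideal:
  assumes "nonassoc_ideal I A"
  shows "nonassoc_ideal (fst ` I) B"
proof (rule nonassoc_idealI)
  interpret I: nonassoc_ideal I A by fact
  show sub: "fst ` I \<subseteq> carrier B" using I.a_subset by force
  show "\<zero> \<in> fst ` I" using I.zero_closed by force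
  fix a assume "a \<in> fst ` I"
  then obtain b where ab: "(a, b) \<in> I" by auto
  then have car: "a \<in> carrier B" "b \<in> carrier B" using I.a_Hcarr by auto
  show "\<ominus> a \<in> fst ` I"
    using I.minus_mem[OF ab] car by force
  show "a \<oplus> c \<in> fst ` I" if c: "c \<in> fst ` I" for c
    using I.a_closed[OF ab] c by force
  fix x assume x: "x \<in> carrier B"
  have "st Grp_e Grp_e a x \<in> fst ` I" "st Grp_e Grp_e x a \<in> fst ` I"
    using ideal_mult_base[OF assms ab x] by force+
  then show "x \<otimes> a \<in> fst ` I" "a \<otimes> x \<in> fst ` I"
    using mult_mem_if_st_mem[OF sub x] \<open>a \<in> fst ` I\<close> by blast+
qed

text \<open>Multiplication by u moves \<open>b\<close>, up to the unit \<alpha>, into the first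
  coordinate.\<close>

lemma projection_snd:
  assumes "nonassoc_ideal I A" "(a, b) \<in> I"
  shows "b \<in> fst ` I"
proof -
  interpret I: nonassoc_ideal I A by fact
  have "b \<in> carrier B" using I.a_Hcarr[OF assms(2)] by auto
  moreover have "b \<otimes> \<alpha> \<in> fst ` I" using ideal_mult_u(1)[OF assms] by force
  ultimately show ?thesis by (rule mem_ideal_if_mult_alpha[OF projection_ideal[OF assms(1)]])
qed

text \<open>Left multiplication by u turns (a, b) into an element with second coordinate \<sigma> a,
  and second coordinates lie in the projection.\<close>

lemma projection_invariant:
  assumes "nonassoc_ideal I A"
  shows "\<sigma> ` fst ` I \<subseteq> fst ` I"
  using projection_snd[OF assms ideal_mult_u(2)[OF assms]] by auto

lemma base_part_ideal:
  assumes "nonassoc_ideal I A"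
  shows "nonassoc_ideal {a. (a, \<zero>) \<in> I} B"
proof (rule nonassoc_idealI)
  interpret I: nonassoc_ideal I A by fact
  show sub: "{a. (a, \<zero>) \<in> I} \<subseteq> carrier B" using I.a_subset by auto
  show "\<zero> \<in> {a. (a, \<zero>) \<in> I}" using I.zero_closed by simp
  fix a assume a: "a \<in> {a. (a, \<zero>) \<in> I}"
  then have car: "a \<in> carrier B" using sub by blast
  show "\<ominus> a \<in> {a. (a, \<zero>) \<in> I}"
    using I.minus_mem[of "(a, \<zero>)"] a car minus_equality[of \<zero> \<zero>] by simp
  show "a \<oplus> c \<in> {a. (a, \<zero>) \<in> I}" if "c \<in> {a. (a, \<zero>) \<in> I}" for c
    using I.a_closed[of "(a, \<zero>)" "(c, \<zero>)"] a that by simp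
  fix x assume x: "x \<in> carrier B"
  have "st Grp_e Grp_e a x \<in> {a. (a, \<zero>) \<in> I}" "st Grp_e Grp_e x a \<in> {a. (a, \<zero>) \<in> I}"
    using ideal_mult_base[OF assms _ x, of a \<zero>] a x by auto
  then show "x \<otimes> a \<in> {a. (a, \<zero>) \<in> I}" "a \<otimes> x \<in> {a. (a, \<zero>) \<in> I}"
    using mult_mem_if_st_mem[OF sub x a] by blast+
qed

text \<open>Multiplication by u gives (b \<alpha>, \<zero>), and \<alpha> cancels inside the base
  part, which is an ideal of \<open>B\<close>.\<close>

lemma base_part_if_snd:
  assumes "nonassoc_ideal I A" "(\<zero>, b) \<in> I"
  shows "(b, \<zero>) \<in> I"
proof -
  interpret I: nonassoc_ideal I A by fact
  have "b \<in> carrier B" using I.a_Hcarr[OF assms(2)] by auto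
  then show ?thesis
    using mem_ideal_if_mult_alpha[OF base_part_ideal[OF assms(1)]] ideal_mult_u(1)[OF assms]
    by simp
qed

lemma base_part_invariant:
  assumes "nonassoc_ideal I A"
  shows "\<sigma> ` {a. (a, \<zero>) \<in> I} \<subseteq> {a. (a, \<zero>) \<in> I}"
proof clarsimp
  interpret I: nonassoc_ideal I A by fact
  fix a assume "(a, \<zero>) \<in> I"
  then have "(\<zero>, \<sigma> a) \<in> I"
    using ideal_mult_u(2)[OF assms, of a \<zero>] by (simp add: l_null)
  then show "(\<sigma> a, \<zero>) \<in> I" by (rule base_part_if_snd[OF assms])
qed

text \<open>With zero base part, \<open>I\<close> is the graph of an injective partial map: the
  difference of two elements sharing a coordinate has a vanishing coordinate, and its other
  coordinate lies in the base part.\<close>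

lemma ideal_inj:
  assumes "nonassoc_ideal I A" "{a. (a, \<zero>) \<in> I} = {\<zero>}" "(a, b) \<in> I" "(c, d) \<in> I"
  shows "a = c \<longleftrightarrow> b = d"
proof -
  interpret I: nonassoc_ideal I A by fact
  have car: "a \<in> carrier B" "b \<in> carrier B" "c \<in> carrier B" "d \<in> carrier B"
    using I.a_Hcarr assms(3,4) by auto
  have diff: "(a \<ominus> c, b \<ominus> d) \<in> I"
    using I.diff_mem[OF assms(3,4)] car by (simp add: doubling_diff)
  show ?thesis
  proof
    assume "a = c"
    then have "b \<ominus> d \<in> {a. (a, \<zero>) \<in> I}"
      using diff car base_part_if_snd[OF assms(1)] by (simp add: a_minus_def r_neg)
    then show "b = d" using assms(2) car diff_eq_zeroD by blast
  next
    assume "b = d"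
    then have "a \<ominus> c \<in> {a. (a, \<zero>) \<in> I}"
      using diff car by (simp add: a_minus_def r_neg)
    then show "a = c" using assms(2) car diff_eq_zeroD by blast
  qed
qed

lemma central_if_base_part_zero:
  assumes I: "nonassoc_ideal I A" and zero: "{a. (a, \<zero>) \<in> I} = {\<zero>}" and b: "(\<one>, b) \<in> I"
  shows "(\<one>, b) \<in> center A"
proof -
  interpret I: nonassoc_ideal I A by fact
  have bc: "b \<in> carrier B" using I.a_Hcarr[OF b] by auto
  \<comment> \<open>The two products of (\<one>, b) with (c, \<zero>) share the first coordinate
    \<open>c\<close>, so their second coordinates agree.\<close>
  have comm_base: "st Grp_g Grp_e b (\<sigma> c) = st Grp_e Grp_g c b" if c: "c \<in> carrier B" for c
    using ideal_inj[OF I zero ideal_mult_base[OF I b c]] c by simp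
  \<comment> \<open>The two products with (\<zero>, d) share the second coordinate \<open>d\<close>,
    because \<sigma> fixes \<one>; so their first coordinates agree.\<close>
  have comm_u: "st Grp_g Grp_g b (\<sigma> d) \<otimes> \<alpha> = st Grp_g Grp_g d (\<sigma> b) \<otimes> \<alpha>"
    if d: "d \<in> carrier B" for d
  proof -
    have "(\<zero>, d) \<in> carrier A" using d by simp
    from ideal_inj[OF I zero I.ideal_right[OF b this, unfolded doubling_mult]
        I.ideal_left[OF b this, unfolded doubling_mult]]
    show ?thesis using d bc by (simp add: mult_closed unit_closed)
  qed
  have "(\<one>, b) \<otimes>\<^bsub>A\<^esub> (c, d) = (c, d) \<otimes>\<^bsub>A\<^esub> (\<one>, b)"
    if "c \<in> carrier B" "d \<in> carrier B" for c d
    using that bc by (simp add: doubling_mult comm_base comm_u a_comm unit_closed)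
  then show ?thesis using bc unit_closed by (auto simp: center_def)
qed

end

section \<open>Intersecting with the center, and part (b)\<close>

lemma (in nonassoc_ring) ideal_Int_center:
  assumes "nonassoc_ideal I R" "nonassoc_ring (center_ring R)"
  shows "nonassoc_ideal (I \<inter> center R) (center_ring R)"
proof -
  interpret I: nonassoc_ideal I R by fact
  \<comment> \<open>Closure of the center under multiplication comes from this assumption: commuting
    elements alone need not form a subring.\<close>
  interpret Z: nonassoc_ring "center_ring R" by fact
  have Zs [simp]: "carrier (center_ring R) = center R" "add (center_ring R) = add R"
    "mult (center_ring R) = mult R" "zero (center_ring R) = \<zero>"
    by (simp_all add: center_ring_def)
  have sub: "center R \<subseteq> carrier R" by (auto simp: center_def)
  \<comment> \<open>Negation in \<open>center_ring R\<close> is defined by an inverse sought in the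
    smaller carrier; uniqueness of inverses in \<open>R\<close> identifies it with the negation of
    \<open>R\<close>.\<close>
  have minus: "\<ominus>\<^bsub>center_ring R\<^esub> z = \<ominus> z" if z: "z \<in> center R" for z
  proof -
    have "\<ominus>\<^bsub>center_ring R\<^esub> z \<in> center R" "\<ominus>\<^bsub>center_ring R\<^esub> z \<oplus> z = \<zero>"
      using Z.a_inv_closed[of z] Z.l_neg[of z] z by simp_all
    then show ?thesis using minus_equality sub z by (metis subsetD)
  qed
  show ?thesis
  proof (rule Z.nonassoc_idealI)
    fix a assume "a \<in> I \<inter> center R"
    then show "\<ominus>\<^bsub>center_ring R\<^esub> a \<in> I \<inter> center R"
      using I.minus_mem minus Z.a_inv_closed[of a] by simp
  qed (use sub Z.zero_closed Z.a_closed Z.mult_closed in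
      \<open>auto intro: I.ideal_left I.ideal_right\<close>)
qed

lemma (in unital_nonassoc_ring) one_mem_center: "\<one> \<in> center R"
  by (simp add: center_def unit_closed unit_left unit_right)

lemma (in cayley_dickson) doubling_simple:
  assumes B: "sigma_simple_ring B \<sigma>" and Z: "simple_nonassoc_ring (center_ring A)"
  shows "simple_nonassoc_ring A"
proof unfold_locales
  fix I assume I: "nonassoc_ideal I A"
  interpret I: nonassoc_ideal I A by fact
  note trivial = sigma_simple_ring.trivial_invariant_ideals[OF B]
  have "\<one>\<^bsub>A\<^esub> \<in> I" if nonzero: "I \<noteq> {\<zero>\<^bsub>A\<^esub>}"
  proof -
    have "fst ` I \<noteq> {\<zero>}"
    proof
      assume fst0: "fst ` I = {\<zero>}"
      \<comment> \<open>Second coordinates lie in the projection too, so they vanish with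
        it.\<close>
      have "x \<in> {\<zero>\<^bsub>A\<^esub>}" if "x \<in> I" for x
        using projection_snd[OF I, of "fst x" "snd x"] fst0 imageI[OF that, of fst] that
        by (simp add: prod_eq_iff)
      then show False using nonzero I.zero_closed by blast
    qed
    then have "\<one> \<in> fst ` I"
      using trivial[OF projection_ideal[OF I] projection_invariant[OF I]] unit_closed by blast
    then obtain b where b: "(\<one>, b) \<in> I" by auto
    consider "{a. (a, \<zero>) \<in> I} = {\<zero>}" | "{a. (a, \<zero>) \<in> I} = carrier B"
      using trivial[OF base_part_ideal[OF I] base_part_invariant[OF I]] by blast
    then show ?thesis
    proof cases
      case 1
      have "nonassoc_ideal (I \<inter> center A) (center_ring A)"
        using A.ideal_Int_center[OF I] Z by (simp add: simple_nonassoc_ring_def)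
      then have "I \<inter> center A = {\<zero>\<^bsub>A\<^esub>} \<or> I \<inter> center A = center A"
        using simple_nonassoc_ring.trivial_ideals[OF Z] by (simp add: center_ring_def)
      then show ?thesis
      proof
        assume "I \<inter> center A = {\<zero>\<^bsub>A\<^esub>}"
        \<comment> \<open>No contradiction is available, since \<open>B\<close> may be the zero
          ring; but now b = \<zero>, so the element (\<one>, b) of \<open>I\<close> is the unit of
          \<open>A\<close>.\<close>
        then have "(\<one>, b) = (\<zero>, \<zero>)"
          using central_if_base_part_zero[OF I 1 b] b by auto
        then show ?thesis using b by simp
      next
        assume "I \<inter> center A = center A"
        then show ?thesis using A.one_mem_center by blast
      qed
    next
      case 2
      then show ?thesis using unit_closed by auto
    qed
  qed
  then show "I = {\<zero>\<^bsub>A\<^esub>} \<or> I = carrier A"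
    using A.ideal_eq_carrier[OF I] by blast
qed

theorem proposition3p19:
  fixes B :: "('a, 'm) ring_scheme"
    and \<sigma> :: "'a \<Rightarrow> 'a"
    and \<alpha> :: 'a
    and st :: "order_two \<Rightarrow> order_two \<Rightarrow> 'a \<Rightarrow> 'a \<Rightarrow> 'a"
  assumes "cayley_dickson B \<sigma> \<alpha> st"
  shows "(simple_nonassoc_ring (doubling B \<sigma> \<alpha> st) \<longrightarrow> sigma_simple_ring B \<sigma>) \<and>
    (classical_cayley_dickson B \<sigma> \<alpha> st \<and>
      sigma_simple_ring (doubling B \<sigma> \<alpha> st) (extended_sigma B \<sigma>)
      \<longrightarrow> sigma_simple_ring B \<sigma>) \<and>
    (sigma_simple_ring B \<sigma> \<and> simple_nonassoc_ring (center_ring (doubling B \<sigma> \<alpha> st))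
      \<longrightarrow> simple_nonassoc_ring (doubling B \<sigma> \<alpha> st))"
  using cayley_dickson.sigma_simple_if_doubling_simple[OF assms]
    cayley_dickson.sigma_simple_if_doubling_sigma_simple[OF assms]
    cayley_dickson.doubling_simple[OF assms]
  by blast

end
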